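(* Let $d\ge 0$ be an integer, let $n=\lfloor d/2\rfloor$, and let $\varepsilon=+$ if $d$ is even and $\varepsilon=-$ if $d$ is odd. Let $M^{(g)}_d$ be the $(d+1)\times(n+1)$ matrix with entries $$M^{(g)}_d(i,k)=\binom{d-k+1}{d-i+1}-\binom{k}{d-i+1},\qquad 0\le i\le d,\ 0\le k\le n.$$ Define, for non-negative integers $i,j,k$, $$A_\pm(i,j)=\binom{j+1}{i-j}\mp\binom{j}{i-j-1},\qquad G_+(j,k)=\frac{2k+1}{2j+1}\binom{k+j}{2j},\qquad G_-(j,k)=\binom{k+j+1}{2j+1}.$$ Then for all $0\le i\le d$ and $0\le k\le n$, $$M^{(g)}_d(i,k)=\sum_{j=0}^{n}A_\varepsilon(i,j)\,G_\varepsilon(n-j,\,n-k).$$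
   Context: Binomial coefficients follow the convention $\binom{a}{b}=0$ whenever $b<0$ or $b>a$ (for integers $a\ge 0$). The matrix $M^{(g)}_d$ is the matrix expressing the face numbers $f_0,\dots,f_d$ of a $d$-dimensional simple polytope ($f_i$ = number of codimension-$i$ faces) in terms of its $g$-numbers $g_0,\dots,g_n$, where $\sum_i f_i t^{d-i}=\sum_{k=0}^{n} g_k\sum_{j=k}^{d-k}(1+t)^j$; its entries are as given explicitly in the claim. *)

theory Defs
  imports "Jordan_Normal_Form.Matrix"
begin

text \<open>Binomial coefficients with integer arguments, zero whenever \<open>b < 0\<close> or \<open>b > a\<close>. Both
  arguments are integers so that differences such as \<open>i - j - 1\<close> are not truncated at zero.\<close>

definition binom :: "int \<Rightarrow> int \<Rightarrow> rat" where
  "binom a b = (if 0 \<le> b \<and> b \<le> a then of_nat (nat a choose nat b) else 0)"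

definition Mg :: "nat \<Rightarrow> rat mat" where
  "Mg d = mat (d + 1) (d div 2 + 1)
     (\<lambda>(i, k). binom (int d - int k + 1) (int d - int i + 1) - binom (int k) (int d - int i + 1))"

datatype sign = Plus | Minus

definition parity_sign :: "nat \<Rightarrow> sign" where
  "parity_sign d = (if even d then Plus else Minus)"

fun A :: "sign \<Rightarrow> nat \<Rightarrow> nat \<Rightarrow> rat" where
  "A Plus i j = binom (int j + 1) (int i - int j) - binom (int j) (int i - int j - 1)"
| "A Minus i j = binom (int j + 1) (int i - int j) + binom (int j) (int i - int j - 1)"

fun G :: "sign \<Rightarrow> nat \<Rightarrow> nat \<Rightarrow> rat" where
  "G Plus j k = (2 * of_nat k + 1) / (2 * of_nat j + 1) * binom (int k + int j) (2 * int j)"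
| "G Minus j k = binom (int k + int j + 1) (2 * int j + 1)"

end

theory Submission
  imports Defs "HOL-Computational_Algebra.Polynomial"
begin

text \<open>
  Column \<open>k\<close> of \<open>M\<^sup>(\<^sup>g\<^sup>)\<close> has the generating polynomial \<open>x\<^sup>k (1+x)\<^bsup>d+1-k\<^esup> - x\<^bsup>d+1-k\<^esup> (1+x)\<^sup>k\<close> in the row
  index. With \<open>y = x (1+x)\<close> and \<open>r = n - k\<close> it equals \<open>y\<^sup>k ((1+x)\<^sup>m - x\<^sup>m)\<close>, where \<open>m = 2r+1\<close> for
  even \<open>d\<close> and \<open>m = 2r+2\<close> for odd \<open>d\<close>. Column \<open>j\<close> of \<open>A\<close> has the generating polynomial \<open>y\<^sup>j\<close> or
  \<open>(1+2x) y\<^sup>j\<close>. So the claim is the expansion of \<open>(1+x)\<^sup>m - x\<^sup>m\<close> in powers of \<open>y\<close>. Both sides of that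
  expansion satisfy \<open>u\<^bsub>r+2\<^esub> = (1+2y) u\<^bsub>r+1\<^esub> - y\<^sup>2 u\<^sub>r\<close>, since \<open>(1+x)\<^sup>2 + x\<^sup>2 = 1 + 2y\<close>.
\<close>

section \<open>Binomial coefficients as polynomial coefficients\<close>

lemma binom_int: "binom (int a) (int b) = of_nat (a choose b)"
  by (auto simp: binom_def)

lemma binom_int_diff: "binom (int a) (int i - int j) = (if j \<le> i then of_nat (a choose (i - j)) else 0)"
  by (auto simp: binom_def nat_diff_distrib)

lemma coeff_X_power_times_1_plus_X_power:
  "coeff ([:0, 1:] ^ j * [:1, 1:] ^ a) i = binom (int a) (int i - int j)"
proof -
  have "coeff ([:1, 1 :: rat:] ^ a) m = of_nat (a choose m)" for m
  proof (cases "m \<le> a")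
    case False
    then have "degree ([:1, 1 :: rat:] ^ a) < m"
      by (simp add: degree_power_eq)
    with False show ?thesis
      by (simp add: coeff_eq_0 binomial_eq_0)
  qed (simp add: coeff_linear_poly_power)
  moreover have "[:0, 1 :: rat:] ^ j = monom 1 j"
    by (simp add: monom_altdef)
  ultimately show ?thesis
    by (simp add: binom_int_diff coeff_monom_mult)
qed

text \<open>Both sides expand by Pascal's rule to \<open>(m choose q) + 2 * (m choose (q + 1)) + 2 *
  (m choose (q + 2))\<close>.\<close>

lemma binomial_second_difference:
  "((m + 2) choose (q + 2)) + (m choose (q + 2)) = (m choose q) + 2 * ((m + 1) choose (q + 2))"
  by simp

section \<open>Expansions in powers of \<open>y\<close> and their recurrence\<close>

text \<open>The coefficientwise form of the recurrence for \<open>u\<close>, for \<open>u\<^sub>r = (\<Sum>s\<le>r. g s r * y ^ (r - s))\<close>.\<close>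

definition pascal_like :: "(nat \<Rightarrow> nat \<Rightarrow> rat) \<Rightarrow> bool" where
  "pascal_like g \<longleftrightarrow> (\<forall>r s. r < s \<longrightarrow> g s r = 0) \<and>
     (\<forall>r. g 0 (r + 2) + g 0 r = 2 * g 0 (r + 1)) \<and>
     (\<forall>r s. g (Suc s) (r + 2) + g (Suc s) r = g s (r + 1) + 2 * g (Suc s) (r + 1))"

definition expansion :: "(nat \<Rightarrow> nat \<Rightarrow> rat) \<Rightarrow> rat poly \<Rightarrow> nat \<Rightarrow> rat poly" where
  "expansion g y r = (\<Sum>s\<le>r. smult (g s r) (y ^ (r - s)))"

text \<open>The terms with \<open>s > r\<close> vanish, so expansions for different \<open>r\<close>
  can be written over one common range of \<open>s\<close>.\<close>

lemma expansion_extend: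
  assumes "pascal_like g" "r \<le> N"
  shows "(\<Sum>s\<le>N. smult (g s r) (y ^ (N - s))) = y ^ (N - r) * expansion g y r"
proof -
  have "(\<Sum>s\<le>N. smult (g s r) (y ^ (N - s))) = (\<Sum>s\<le>r. smult (g s r) (y ^ (N - s)))"
    using assms by (intro sum.mono_neutral_right) (auto simp: pascal_like_def)
  also have "\<dots> = (\<Sum>s\<le>r. y ^ (N - r) * smult (g s r) (y ^ (r - s)))"
    using assms(2) by (intro sum.cong) (auto simp flip: power_add)
  finally show ?thesis
    by (simp add: expansion_def sum_distrib_left)
qed

lemma expansion_recurrence:
  assumes g: "pascal_like g"
  shows "expansion g y (r + 2) + y\<^sup>2 * expansion g y r = (1 + 2 * y) * expansion g y (r + 1)"
proof -
  let ?N = "r + 2"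
  \<comment> \<open>Shifting \<open>g\<close> by one, with 0 in front, merges the cases
    \<open>0\<close> and \<open>Suc s\<close> of the recurrence into one.\<close>
  define h where "h s = (case s of 0 \<Rightarrow> 0 | Suc s' \<Rightarrow> g s' (r + 1))" for s
  have rec: "g s (r + 2) + g s r = h s + 2 * g s (r + 1)" for s
    using g by (cases s) (auto simp: pascal_like_def h_def)
  have h: "(\<Sum>s\<le>?N. smult (h s) (y ^ (?N - s))) = expansion g y (r + 1)"
    by (simp add: expansion_def h_def sum.atMost_Suc_shift del: sum.atMost_Suc)
  have g1: "(\<Sum>s\<le>?N. smult (g s (r + 1)) (y ^ (?N - s))) = y * expansion g y (r + 1)"
    using expansion_extend [OF g, of "r + 1" ?N] by simp
  have g0: "(\<Sum>s\<le>?N. smult (g s r) (y ^ (?N - s))) = y\<^sup>2 * expansion g y r"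
    using expansion_extend [OF g, of r ?N] by simp
  have "expansion g y (r + 2) + y\<^sup>2 * expansion g y r =
      (\<Sum>s\<le>?N. smult (g s (r + 2) + g s r) (y ^ (?N - s)))"
    by (simp only: smult_add_left sum.distrib g0 expansion_def [of g y "r + 2"])
  also have "\<dots> = (\<Sum>s\<le>?N. smult (h s) (y ^ (?N - s))) + 2 * (\<Sum>s\<le>?N. smult (g s (r + 1)) (y ^ (?N - s)))"
    unfolding rec by (simp only: smult_add_left mult_2 sum.distrib)
  finally show ?thesis
    unfolding h g1 by (simp add: algebra_simps)
qed

text \<open>A linear recurrence of order two is determined by two initial values; the factor
  \<open>c\<close> provides for the \<open>1 + 2 * x\<close> of odd \<open>d\<close>.\<close>

lemma expansion_unique:
  assumes "pascal_like g"
    and "\<And>r. u (r + 2) + y\<^sup>2 * u r = (1 + 2 * y) * u (r + 1)"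
    and "u 0 = c * expansion g y 0" and "u 1 = c * expansion g y 1"
  shows "u r = c * expansion g y r"
proof (induction r rule: induct_nat_012)
  case (ge2 r)
  have "u (r + 2) = (1 + 2 * y) * u (r + 1) - y\<^sup>2 * u r"
    using assms(2) [of r] by (simp add: algebra_simps)
  also have "\<dots> = c * ((1 + 2 * y) * expansion g y (r + 1) - y\<^sup>2 * expansion g y r)"
    using ge2 by (simp add: algebra_simps)
  also have "(1 + 2 * y) * expansion g y (r + 1) - y\<^sup>2 * expansion g y r = expansion g y (r + 2)"
    by (simp only: expansion_recurrence [OF assms(1), symmetric] add_diff_cancel_right')
  finally show ?case by simp
qed (use assms in auto)

text \<open>The squares of \<open>a\<close> and \<open>b\<close> have sum
  \<open>1 + 2 * (a * b)\<close>, because \<open>a - b = 1\<close>, and product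
  \<open>(a * b)\<^sup>2\<close>. The offset \<open>e\<close> serves both parities.\<close>

lemma power_diff_recurrence:
  fixes a b :: "'a::comm_ring_1"
  assumes "a - b = 1"
  shows "(a ^ (2 * (r + 2) + e) - b ^ (2 * (r + 2) + e)) + (a * b)\<^sup>2 * (a ^ (2 * r + e) - b ^ (2 * r + e)) =
    (1 + 2 * (a * b)) * (a ^ (2 * (r + 1) + e) - b ^ (2 * (r + 1) + e))"
proof -
  have "1 + 2 * (a * b) = (a - b)\<^sup>2 + 2 * (a * b)"
    using assms by simp
  also have "\<dots> = a\<^sup>2 + b\<^sup>2"
    by (simp add: power2_eq_square algebra_simps)
  finally have ab: "1 + 2 * (a * b) = a\<^sup>2 + b\<^sup>2" .
  show ?thesis
    unfolding ab by (simp add: power_add power2_eq_square algebra_simps)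
qed

section \<open>The arrays \<open>G\<close> as binomial coefficients\<close>

lemma G_Minus: "G Minus s r = of_nat ((r + s + 1) choose (2 * s + 1))"
proof -
  have "int r + int s + 1 = int (r + s + 1)" "2 * int s + 1 = int (2 * s + 1)"
    by simp_all
  then show ?thesis
    by (simp only: G.simps binom_int)
qed

text \<open>By Pascal's rule the right side is \<open>(r + s choose 2 * s)\<close> plus twice
  \<open>(r + s choose (2 * s + 1))\<close>; absorption turns this into the fraction.\<close>

lemma G_Plus: "G Plus s r = of_nat ((r + s + 1) choose (2 * s + 1)) + of_nat ((r + s) choose (2 * s + 1))"
proof -
  have absorb: "(2 * s + 1) * ((r + s) choose (2 * s + 1)) = (r + s - 2 * s) * ((r + s) choose (2 * s))"
    using binomial_absorb_comp [of "r + s" "2 * s"] binomial_absorption [of "2 * s" "r + s"] by simp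
  \<comment> \<open>Adding a multiple of the binomial to both sides avoids the truncated difference;
    for \<open>2 * s > r + s\<close> all binomials vanish.\<close>
  have "(2 * s + 1) * ((r + s) choose (2 * s + 1)) + (2 * s) * ((r + s) choose (2 * s)) =
      (r + s) * ((r + s) choose (2 * s))"
  proof (cases "2 * s \<le> r + s")
    case True
    then show ?thesis
      unfolding absorb by (simp flip: add_mult_distrib)
  qed (simp add: binomial_eq_0)
  hence "(2 * of_nat s + 1) * of_nat ((r + s) choose (2 * s + 1)) + (2 * of_nat s) * of_nat ((r + s) choose (2 * s)) 
    = (of_nat r + of_nat s :: rat) * of_nat ((r + s) choose (2 * s))"
    by (simp only: of_nat_add of_nat_mult of_nat_numeral of_nat_1 flip: of_nat_eq_iff [where ?'a = rat])
  moreover have "G Plus s r = (2 * of_nat r + 1) / (2 * of_nat s + 1) * of_nat ((r + s) choose (2 * s))"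
    using binom_int [of "r + s" "2 * s"] by simp
  moreover have "(2 * of_nat s + 1 :: rat) \<noteq> 0"
    by (metis of_nat_Suc of_nat_eq_0_iff of_nat_mult of_nat_numeral nat.distinct(1) add.commute)
  ultimately show ?thesis
    by (simp add: field_simps)
qed

text \<open>For \<open>e \<le> 1\<close>, \<open>r < s\<close> gives
  \<open>r + s + e < 2 * s + 1\<close>, hence the zeros. Row 0 is affine in \<open>r\<close>; the
  other rows use the second difference.\<close>

lemma pascal_like_of_binomials:
  assumes "\<And>s r. g s r = of_nat ((r + s + e) choose (2 * s + 1))" and "e \<le> 1"
  shows "pascal_like g"
  unfolding pascal_like_def assms(1)
proof (intro conjI allI impI)
  fix r s :: nat
  have "((r + Suc s + e + 2) choose (2 * s + 1 + 2)) + ((r + Suc s + e) choose (2 * s + 1 + 2)) =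
      ((r + Suc s + e) choose (2 * s + 1)) + 2 * ((r + Suc s + e + 1) choose (2 * s + 1 + 2))"
    using binomial_second_difference [of "r + Suc s + e" "2 * s + 1"] .
  moreover have "r + 2 + Suc s + e = r + Suc s + e + 2" "r + 1 + s + e = r + Suc s + e"
      "r + 1 + Suc s + e = r + Suc s + e + 1" "2 * Suc s + 1 = 2 * s + 1 + 2"
    by simp_all
  ultimately show "of_nat ((r + 2 + Suc s + e) choose (2 * Suc s + 1)) + of_nat ((r + Suc s + e) choose (2 * Suc s + 1)) =
      of_nat ((r + 1 + s + e) choose (2 * s + 1)) + 2 * (of_nat ((r + 1 + Suc s + e) choose (2 * Suc s + 1)) :: rat)"
    by (metis of_nat_add of_nat_mult of_nat_numeral)
qed (use assms(2) in \<open>auto simp: binomial_eq_0\<close>)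

lemma pascal_like_add: "pascal_like g \<Longrightarrow> pascal_like h \<Longrightarrow> pascal_like (\<lambda>s r. g s r + h s r)"
  by (simp add: pascal_like_def algebra_simps)

lemma pascal_like_G_Minus: "pascal_like (G Minus)"
  by (rule pascal_like_of_binomials [where e = 1]) (simp_all only: G_Minus le_refl)

lemma pascal_like_G_Plus: "pascal_like (G Plus)"
proof -
  have "G Plus = (\<lambda>s r. of_nat ((r + s + 1) choose (2 * s + 1)) + of_nat ((r + s + 0) choose (2 * s + 1)))"
    by (intro ext) (simp only: G_Plus add_0_right)
  moreover have "pascal_like \<dots>"
    by (intro pascal_like_add; rule pascal_like_of_binomials [OF refl]) auto
  ultimately show ?thesis
    by simp
qed

section \<open>Generating polynomials of the columns\<close>

context
  fixes x y :: "rat poly"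
  defines "x \<equiv> [:0, 1:]" and "y \<equiv> (1 + x) * x"
begin

lemma expansion_G_Plus: "(1 + x) ^ (2 * r + 1) - x ^ (2 * r + 1) = expansion (G Plus) y r"
proof -
  have "(1 + x) ^ (2 * r + 1) - x ^ (2 * r + 1) = 1 * expansion (G Plus) y r"
  proof (rule expansion_unique [OF pascal_like_G_Plus])
    show "(1 + x) ^ (2 * (r + 2) + 1) - x ^ (2 * (r + 2) + 1)
        + y\<^sup>2 * ((1 + x) ^ (2 * r + 1) - x ^ (2 * r + 1)) =
      (1 + 2 * y) * ((1 + x) ^ (2 * (r + 1) + 1) - x ^ (2 * (r + 1) + 1))" for r
      unfolding y_def by (rule power_diff_recurrence) simp
  qed (simp_all add: expansion_def G_Plus y_def x_def power3_eq_cube one_pCons eval_nat_numeral del: G.simps)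
  then show ?thesis by simp
qed

text \<open>The initial values are \<open>1 + 2 * x\<close> and
  \<open>(1 + 2 * x) * (1 + 2 * y)\<close>, which explains the factor.\<close>

lemma expansion_G_Minus: "(1 + x) ^ (2 * r + 2) - x ^ (2 * r + 2) = (1 + 2 * x) * expansion (G Minus) y r"
proof (rule expansion_unique [OF pascal_like_G_Minus])
  show "(1 + x) ^ (2 * (r + 2) + 2) - x ^ (2 * (r + 2) + 2)
      + y\<^sup>2 * ((1 + x) ^ (2 * r + 2) - x ^ (2 * r + 2)) =
    (1 + 2 * y) * ((1 + x) ^ (2 * (r + 1) + 2) - x ^ (2 * (r + 1) + 2))" for r
    unfolding y_def by (rule power_diff_recurrence) simp
qed (simp_all add: expansion_def G_Minus y_def x_def one_pCons numeral_poly eval_nat_numeral del: G.simps)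

lemma coeff_powers: "coeff (x ^ j * (1 + x) ^ a) i = binom (int a) (int i - int j)"
  using coeff_X_power_times_1_plus_X_power [of j a i] by (simp add: x_def one_pCons)

definition "A_factor \<epsilon> = (case \<epsilon> of Plus \<Rightarrow> 1 | Minus \<Rightarrow> 1 + 2 * x)"

lemma y_power: "y ^ j = x ^ j * (1 + x) ^ j"
  by (simp add: y_def power_mult_distrib)

text \<open>Writing 1 as \<open>(1 + x) - x\<close> and \<open>1 + 2 * x\<close> as
  \<open>(1 + x) + x\<close> produces the two binomials of \<open>A\<close>.\<close>

lemma coeff_A: "coeff (A_factor \<epsilon> * y ^ j) i = A \<epsilon> i j"
proof (cases \<epsilon>)
  case Plus
  have "A_factor \<epsilon> * y ^ j = x ^ j * (1 + x) ^ (j + 1) - x ^ (j + 1) * (1 + x) ^ j"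
    by (simp add: A_factor_def Plus y_power algebra_simps)
  then show ?thesis
    by (simp only: coeff_diff coeff_powers Plus A.simps) (simp add: diff_diff_eq add.commute)
next
  case Minus
  have "A_factor \<epsilon> * y ^ j = x ^ j * (1 + x) ^ (j + 1) + x ^ (j + 1) * (1 + x) ^ j"
    by (simp add: A_factor_def Minus y_power algebra_simps)
  then show ?thesis
    by (simp only: coeff_add coeff_powers Minus A.simps) (simp add: diff_diff_eq add.commute)
qed

lemma coeff_Mg:
  assumes "i \<le> d" "k \<le> d div 2"
  shows "coeff (x ^ k * (1 + x) ^ (d + 1 - k) - x ^ (d + 1 - k) * (1 + x) ^ k) i = Mg d $$ (i, k)"
proof -
  \<comment> \<open>Symmetry holds for every integer \<open>b\<close>, since outside the range both
    sides are 0.\<close>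
  have reflect: "binom (int a) b = binom (int a) (int a - b)" for a b
    by (auto simp: binom_def nat_diff_distrib intro!: binomial_symmetric)
  have "binom (int d - int k + 1) (int d - int i + 1) = binom (int (d + 1 - k)) (int i - int k)"
    using assms reflect [of "d + 1 - k" "int i - int k"] by (simp add: of_nat_diff algebra_simps)
  moreover have "binom (int k) (int d - int i + 1) = binom (int k) (int i - int (d + 1 - k))"
    using assms reflect [of k "int i - int (d + 1 - k)"] by (simp add: of_nat_diff algebra_simps)
  ultimately show ?thesis
    using assms by (simp only: coeff_diff coeff_powers) (simp add: Mg_def)
qed

lemma Mg_generating_polynomial:
  fixes d :: nat
  defines "n \<equiv> d div 2" and "\<epsilon> \<equiv> parity_sign d"
  assumes "k \<le> n"
  shows "x ^ k * (1 + x) ^ (d + 1 - k) - x ^ (d + 1 - k) * (1 + x) ^ k =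
    A_factor \<epsilon> * (y ^ k * expansion (G \<epsilon>) y (n - k))"
proof -
  define e where "e = (if even d then 1 else 2 :: nat)"
  have "d + 1 - k = k + (2 * (n - k) + e)"
    using assms(3) unfolding n_def e_def by (auto elim!: evenE oddE)
  then have "x ^ k * (1 + x) ^ (d + 1 - k) - x ^ (d + 1 - k) * (1 + x) ^ k =
      y ^ k * ((1 + x) ^ (2 * (n - k) + e) - x ^ (2 * (n - k) + e))"
    by (simp add: y_def power_add power_mult_distrib right_diff_distrib mult_ac)
  also have "(1 + x) ^ (2 * (n - k) + e) - x ^ (2 * (n - k) + e) = A_factor \<epsilon> * expansion (G \<epsilon>) y (n - k)"
    using expansion_G_Plus [of "n - k"] expansion_G_Minus [of "n - k"]
    by (simp add: e_def A_factor_def \<epsilon>_def parity_sign_def)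
  finally show ?thesis
    by (simp only: mult_ac)
qed

lemma Mg_eq_sum:
  fixes d :: nat
  defines "n \<equiv> d div 2" and "\<epsilon> \<equiv> parity_sign d"
  assumes "i \<le> d" "k \<le> n"
  shows "Mg d $$ (i, k) = (\<Sum>j = 0..n. A \<epsilon> i j * G \<epsilon> (n - j) (n - k))"
proof -
  have "pascal_like (G \<epsilon>)"
    using pascal_like_G_Plus pascal_like_G_Minus by (cases \<epsilon>) auto
  from expansion_extend [OF this, of "n - k" n y]
  have "y ^ k * expansion (G \<epsilon>) y (n - k) = (\<Sum>s\<le>n. smult (G \<epsilon> s (n - k)) (y ^ (n - s)))"
    using assms(4) by simp
  \<comment> \<open>Reversing the sum by \<open>s = n - j\<close> gives the row index
    \<open>n - j\<close> of \<open>G\<close>.\<close>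
  also have "\<dots> = (\<Sum>j\<le>n. smult (G \<epsilon> (n - j) (n - k)) (y ^ j))"
    by (rule sum.reindex_bij_witness [of _ "\<lambda>j. n - j" "\<lambda>j. n - j"]) auto
  finally have "x ^ k * (1 + x) ^ (d + 1 - k) - x ^ (d + 1 - k) * (1 + x) ^ k =
      (\<Sum>j\<le>n. smult (G \<epsilon> (n - j) (n - k)) (A_factor \<epsilon> * y ^ j))"
    using Mg_generating_polynomial [of k d] assms by (simp add: sum_distrib_left del: G.simps)
  then have "Mg d $$ (i, k) = coeff (\<Sum>j\<le>n. smult (G \<epsilon> (n - j) (n - k)) (A_factor \<epsilon> * y ^ j)) i"
    using coeff_Mg [of i d k] assms(3,4) by (simp only: n_def)
  then show ?thesis
    by (simp only: coeff_sum coeff_smult coeff_A mult.commute atLeast0AtMost)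
qed

end

theorem mainTheorem2:
  fixes d n i k :: nat and \<epsilon> :: sign
  assumes "n = d div 2"
    and "\<epsilon> = parity_sign d"
    and "i \<le> d" and "k \<le> n"
  shows "Mg d $$ (i, k) = (\<Sum>j = 0..n. A \<epsilon> i j * G \<epsilon> (n - j) (n - k))"
  using assms Mg_eq_sum by blast

end
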